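(* Let $G$ be a graph on $n$ vertices and suppose that $A \in \mathcal{H}(G)$ with $\operatorname{pin}(A) = (\pi,\nu)$. Then for every pair of integers $r \ge \pi$ and $s \ge \nu$ satisfying $r + s \le n$, there exists a matrix $B \in \mathcal{H}(G)$ with $\operatorname{pin}(B) = (r,s)$. If in addition $A$ is real, then $B$ can be taken to be real.
   Context: All graphs are finite, simple and undirected. For a graph $G=(V,E)$ with vertex set $V=\{1,\ldots,n\}$, $\mathcal{H}(G)$ is the set of all complex Hermitian $n\times n$ matrices $A=[a_{ij}]$ such that for $i\neq j$, $a_{ij}\neq 0$ if and only if $ij\in E$ (no condition on the diagonal entries). The partial inertia of a Hermitian matrix $A$ is $\operatorname{pin}(A)=(\pi(A),\nu(A))$, where $\pi(A)$ and $\nu(A)$ are the numbers of positive and of negative eigenvalues of $A$, counted with multiplicity. *)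

theory Defs
  imports
    "Graph_Theory.Pair_Digraph"
    "Jordan_Normal_Form.Char_Poly"
    "Jordan_Normal_Form.Schur_Decomposition"
begin

text \<open>
  Finite simple undirected graphs are values of \<^locale>\<open>pair_graph\<close>: finite, loop-free, and with a
  symmetric arc set \<^term>\<open>parcs G\<close>, so an edge \<open>ij\<close> is the pair of arcs \<open>(i, j)\<close>, \<open>(j, i)\<close>.
  As matrix indices start at 0, the vertex set of a graph on \<open>n\<close> vertices is \<open>{..<n}\<close> instead of
  \<open>{1, ..., n}\<close>.
\<close>

definition hermitian_mat :: "complex mat \<Rightarrow> bool" where
  "hermitian_mat A \<longleftrightarrow> square_mat A \<and> mat_adjoint A = A"

text \<open>The set \<open>H(G)\<close>; it is meaningful for \<^term>\<open>pverts G = {..<n}\<close>.\<close>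

definition graph_mats :: "nat pair_pre_digraph \<Rightarrow> complex mat set" where
  "graph_mats G =
    {A \<in> carrier_mat (card (pverts G)) (card (pverts G)).
       hermitian_mat A \<and>
       (\<forall>i \<in> pverts G. \<forall>j \<in> pverts G. i \<noteq> j \<longrightarrow> (A $$ (i, j) \<noteq> 0 \<longleftrightarrow> (i, j) \<in> parcs G))}"

text \<open>
  Multiplicities of eigenvalues are their orders as roots of the characteristic polynomial. The
  eigenvalues of a Hermitian matrix are real, so summing over real numbers misses none.
\<close>

definition num_pos_eigenvalues :: "complex mat \<Rightarrow> nat" where
  "num_pos_eigenvalues A =
    (\<Sum>x | eigenvalue A (complex_of_real x) \<and> x > 0. order (complex_of_real x) (char_poly A))"

definition num_neg_eigenvalues :: "complex mat \<Rightarrow> nat" where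
  "num_neg_eigenvalues A =
    (\<Sum>x | eigenvalue A (complex_of_real x) \<and> x < 0. order (complex_of_real x) (char_poly A))"

definition pin :: "complex mat \<Rightarrow> nat \<times> nat" where
  "pin A = (num_pos_eigenvalues A, num_neg_eigenvalues A)"

end

theory Submission
  imports Defs
begin

text \<open>
  Every Hermitian matrix \<open>A\<close> can be written \<open>A = S\<^sup>* diag(d) S\<close> with \<open>S\<close> invertible and \<open>d\<close> the list
  of its eigenvalues (\<open>hermitian_congruent_to_eigenvalues\<close>). By Sylvester's law of inertia
  (\<open>sylvester_law_of_inertia\<close>), any such representation of a matrix, for whatever invertible \<open>S\<close>,
  shows its partial inertia in the signs of \<open>d\<close> (\<open>pin_diag_form\<close>). So to raise the inertia of \<open>A\<close>
  it is enough to replace zeros of \<open>d\<close> by numbers \<open>1\<close> and \<open>-1\<close>, in a way that keeps the graph.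

  Let \<open>d\<^sub>j = 0\<close>. Then row \<open>j\<close> of \<open>S\<close> does not contribute to \<open>A\<close> and may be exchanged for any other
  row. Some cofactor of row \<open>j\<close> is nonzero, say the one in column \<open>k\<close>, so \<open>S\<close> stays invertible if
  row \<open>j\<close> becomes the unit vector \<open>e\<^sub>k\<close>. If \<open>d\<^sub>j\<close> is now set to \<open>t\<close>, the matrix changes by
  \<open>t e\<^sub>k e\<^sub>k\<^sup>*\<close> (\<open>exists_rank_one_update_of_zero\<close>). This alters a single diagonal entry, by a real number,
  and so respects both the graph and the reality of the entries. Since \<open>A\<close> has \<open>n - p - q\<close> zero
  coefficients, there is room for \<open>r - p\<close> steps with \<open>t = 1\<close> and \<open>s - q\<close> steps with \<open>t = -1\<close>.
\<close>

section \<open>Hermitian forms in diagonal coordinates\<close>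

definition diag_form :: "nat \<Rightarrow> complex mat \<Rightarrow> (nat \<Rightarrow> real) \<Rightarrow> complex mat" where
  "diag_form n S d = mat_adjoint S * mat_diag n (\<lambda>i. complex_of_real (d i)) * S"

lemma mat_adjoint_carrier [simp, intro]:
  "A \<in> carrier_mat m n \<Longrightarrow> mat_adjoint A \<in> carrier_mat n m"
  unfolding mat_adjoint_def by auto

lemma dim_mat_adjoint [simp]:
  "dim_row (mat_adjoint A) = dim_col A" "dim_col (mat_adjoint A) = dim_row A"
  unfolding mat_adjoint_def by auto

lemma index_mat_adjoint [simp]:
  "i < dim_col A \<Longrightarrow> j < dim_row A \<Longrightarrow> mat_adjoint A $$ (i, j) = conjugate (A $$ (j, i))"
  unfolding mat_adjoint_def by (simp add: mat_of_rows_index)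

lemma mat_adjoint_mult:
  fixes A B :: "complex mat"
  assumes "A \<in> carrier_mat m n" "B \<in> carrier_mat n k"
  shows "mat_adjoint (A * B) = mat_adjoint B * mat_adjoint A"
  using assms by (intro eq_matI) (auto simp: scalar_prod_def mult.commute intro!: sum.cong)

lemma mat_adjoint_adjoint [simp]:
  fixes A :: "complex mat"
  shows "mat_adjoint (mat_adjoint A) = A"
  by (intro eq_matI) auto

lemma diag_form_index:
  assumes "S \<in> carrier_mat n n" "a < n" "b < n"
  shows "diag_form n S d $$ (a, b) = (\<Sum>i<n. of_real (d i) * cnj (S $$ (i, a)) * S $$ (i, b))"
proof -
  have "mat_adjoint S * mat_diag n (\<lambda>i. complex_of_real (d i))
      = mat n n (\<lambda>(i, j). mat_adjoint S $$ (i, j) * of_real (d j))"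
    by (rule mat_diag_mult_right) (use assms in auto)
  then show ?thesis
    using assms by (auto simp: diag_form_def scalar_prod_def atLeast0LessThan mult_ac intro!: sum.cong)
qed

lemma diag_form_carrier [simp]: "S \<in> carrier_mat n n \<Longrightarrow> diag_form n S d \<in> carrier_mat n n"
  unfolding diag_form_def by (meson mat_adjoint_carrier mat_diag_dim mult_carrier_mat)

lemma dim_diag_form [simp]:
  "dim_row (diag_form n S d) = dim_col S" "dim_col (diag_form n S d) = dim_col S"
  by (simp_all add: diag_form_def)

lemma hermitian_diag_form:
  assumes S: "S \<in> carrier_mat n n"
  shows "hermitian_mat (diag_form n S d)"
  unfolding hermitian_mat_def
proof (intro conjI eq_matI)
  show "square_mat (diag_form n S d)" by simp
  fix a b assume ab: "a < dim_row (diag_form n S d)" "b < dim_col (diag_form n S d)"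
  show "mat_adjoint (diag_form n S d) $$ (a, b) = diag_form n S d $$ (a, b)"
    using ab S by (simp add: diag_form_index[OF S] mult_ac)
qed auto

text \<open>
  In the coordinates \<open>y = S x\<close> the quadratic form is a weighted sum of squares, so the signs of \<open>d\<close>
  control where it is positive. This is the only link between \<open>d\<close> and the matrix that the law of
  inertia needs.
\<close>

lemma quadratic_form_diag_form:
  assumes S: "S \<in> carrier_mat n n" and x: "x \<in> carrier_vec n"
  shows "(diag_form n S d *\<^sub>v x) \<bullet>c x = of_real (\<Sum>i<n. d i * (cmod ((S *\<^sub>v x) $ i))\<^sup>2)"
proof -
  have "(diag_form n S d *\<^sub>v x) \<bullet>c x
      = (\<Sum>a<n. (\<Sum>b<n. (\<Sum>i<n. of_real (d i) * cnj (S $$ (i, a)) * S $$ (i, b)) * x $ b) * cnj (x $ a))"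
    using x S
    by (simp add: scalar_prod_def atLeast0LessThan diag_form_index[OF S])
  also have "\<dots> = (\<Sum>a<n. \<Sum>b<n. \<Sum>i<n. of_real (d i) * (S $$ (i, b) * x $ b) * cnj (S $$ (i, a) * x $ a))"
    by (simp add: sum_distrib_right sum_distrib_left mult_ac)
  also have "\<dots> = (\<Sum>a<n. \<Sum>i<n. \<Sum>b<n. of_real (d i) * (S $$ (i, b) * x $ b) * cnj (S $$ (i, a) * x $ a))"
    by (intro sum.cong refl sum.swap)
  also have "\<dots> = (\<Sum>i<n. \<Sum>a<n. \<Sum>b<n. of_real (d i) * (S $$ (i, b) * x $ b) * cnj (S $$ (i, a) * x $ a))"
    by (rule sum.swap)
  also have "\<dots> = (\<Sum>i<n. of_real (d i) * ((\<Sum>b<n. S $$ (i, b) * x $ b) * cnj (\<Sum>a<n. S $$ (i, a) * x $ a)))"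
    by (simp only: cnj_sum sum_product)
       (intro sum.cong refl, subst sum.swap, simp add: sum_distrib_left mult_ac)
  also have "\<dots> = (\<Sum>i<n. of_real (d i) * ((S *\<^sub>v x) $ i * cnj ((S *\<^sub>v x) $ i)))"
    using S x by (intro sum.cong refl) (simp add: scalar_prod_def atLeast0LessThan)
  also have "\<dots> = of_real (\<Sum>i<n. d i * (cmod ((S *\<^sub>v x) $ i))\<^sup>2)"
    by (simp flip: complex_norm_square)
  finally show ?thesis .
qed

section \<open>Sylvester's law of inertia\<close>

text \<open>
  Fewer than \<open>n\<close> homogeneous linear equations in \<open>n\<close> unknowns have a nontrivial solution: padded
  with zero rows, the system has a square matrix of determinant zero.
\<close>

lemma exists_common_kernel_vec:
  fixes vs :: "'a :: field vec list"
  assumes vs: "set vs \<subseteq> carrier_vec n" and len: "length vs < n"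
  shows "\<exists>x \<in> carrier_vec n. x \<noteq> 0\<^sub>v n \<and> (\<forall>v \<in> set vs. v \<bullet> x = 0)"
proof -
  define M where "M = mat_of_rows n (vs @ replicate (n - length vs) (0\<^sub>v n))"
  have M: "M \<in> carrier_mat n n" using len by (auto simp: M_def)
  have row: "row M i = (vs @ replicate (n - length vs) (0\<^sub>v n)) ! i" if "i < n" for i
  proof -
    have "(vs @ replicate (n - length vs) (0\<^sub>v n)) ! i \<in> carrier_vec n"
      using that vs by (cases "i < length vs") (auto simp: nth_append)
    then show ?thesis using that len unfolding M_def by (intro mat_of_rows_row) simp_all
  qed
  have last_row: "row M (n - 1) = 0\<^sub>v n"
  proof -
    have "\<not> n - 1 < length vs" "n - 1 - length vs < n - length vs" "n - 1 < n" using len by linarith+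
    then show ?thesis by (metis row nth_append nth_replicate)
  qed
  have zero: "M $$ (n - 1, i) = 0" if "i < n" for i
  proof -
    have "M $$ (n - 1, i) = row M (n - 1) $ i" using that M by simp
    then show ?thesis using that last_row by simp
  qed
  have MT: "M\<^sup>T \<in> carrier_mat n n" using M by simp
  have "M\<^sup>T *\<^sub>v unit_vec n (n - 1) = 0\<^sub>v n"
    using len M zero by (intro eq_vecI) simp_all
  moreover have "unit_vec n (n - 1) \<noteq> (0\<^sub>v n :: 'a vec)"
    using len by simp
  ultimately have "det M\<^sup>T = 0"
    unfolding det_0_iff_vec_prod_zero[OF MT] by (intro exI[of _ "unit_vec n (n - 1)"] conjI) auto
  then have "det M = 0" using det_transpose[OF M] by simp
  then obtain x where x: "x \<in> carrier_vec n" "x \<noteq> 0\<^sub>v n" "M *\<^sub>v x = 0\<^sub>v n"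
    unfolding det_0_iff_vec_prod_zero[OF M] by blast
  have "v \<bullet> x = 0" if v: "v \<in> set vs" for v
  proof -
    obtain i where i: "i < length vs" "v = vs ! i"
      using v[unfolded in_set_conv_nth] by blast
    then have "i < n" using len by simp
    have "row M i = v" unfolding row[OF \<open>i < n\<close>] using i by (simp add: nth_append)
    then have "v \<bullet> x = (M *\<^sub>v x) $ i" using \<open>i < n\<close> M by simp
    also have "\<dots> = 0" unfolding x(3) using \<open>i < n\<close> by simp
    finally show ?thesis .
  qed
  with x show ?thesis by blast
qed

text \<open>
  If the inequality failed, the equations \<open>(S x)\<^sub>i = 0\<close> for \<open>d\<^sub>i \<le> 0\<close> and \<open>(T x)\<^sub>i = 0\<close> for \<open>e\<^sub>i > 0\<close>
  would be fewer than \<open>n\<close>. On a common solution \<open>x \<noteq> 0\<close> the first representation makes the form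
  positive, the second one makes it at most zero. The hypothesis is about sums of squares
  instead of matrices so that the lemma also applies to \<open>-d\<close> and \<open>-e\<close>, which gives the count of
  the negative coefficients.
\<close>

lemma card_pos_le_if_diag_forms_eq:
  fixes S T :: "complex mat" and d e :: "nat \<Rightarrow> real"
  assumes S: "S \<in> carrier_mat n n" "det S \<noteq> 0" and T: "T \<in> carrier_mat n n"
    and eq: "\<And>x. x \<in> carrier_vec n \<Longrightarrow>
      (\<Sum>i<n. d i * (cmod ((S *\<^sub>v x) $ i))\<^sup>2) = (\<Sum>i<n. e i * (cmod ((T *\<^sub>v x) $ i))\<^sup>2)"
  shows "card {i. i < n \<and> d i > 0} \<le> card {i. i < n \<and> e i > 0}"
proof (rule ccontr)
  assume less: "\<not> ?thesis"
  define vs where "vs = map (row S) (filter (\<lambda>i. \<not> d i > 0) [0..<n]) @ map (row T) (filter (\<lambda>i. e i > 0) [0..<n])"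
  have len: "length (filter P [0..<n]) = card {i. i < n \<and> P i}" for P
  proof -
    have "{i. i < n \<and> P i} = {i. i < length [0..<n] \<and> P ([0..<n] ! i)}" by auto
    then show ?thesis by (simp only: length_filter_conv_card)
  qed
  \<comment> \<open>The number of equations is \<open>n\<close> minus the number of positive \<open>d\<^sub>i\<close> plus that of positive \<open>e\<^sub>i\<close>.\<close>
  have "card {i. i < n \<and> d i > 0} + card {i. i < n \<and> \<not> d i > 0} = n"
    using sum_length_filter_compl[of "\<lambda>i. d i > 0" "[0..<n]"] by (simp add: len)
  then have "length vs < n" using less by (simp add: vs_def len)
  moreover have "set vs \<subseteq> carrier_vec n" using S T by (auto simp: vs_def)
  ultimately obtain x where x: "x \<in> carrier_vec n" "x \<noteq> 0\<^sub>v n" and x0: "\<forall>v \<in> set vs. v \<bullet> x = 0"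
    using exists_common_kernel_vec by blast
  have Sx: "(S *\<^sub>v x) $ i = 0" if "i < n" "\<not> d i > 0" for i
    using x0 that S by (auto simp: vs_def)
  have Tx: "(T *\<^sub>v x) $ i = 0" if "i < n" "e i > 0" for i
    using x0 that T by (auto simp: vs_def)
  have nonneg: "0 \<le> d i * (cmod ((S *\<^sub>v x) $ i))\<^sup>2" if "i < n" for i
    using Sx[OF that] by (cases "d i > 0") auto
  have "e i * (cmod ((T *\<^sub>v x) $ i))\<^sup>2 \<le> 0" if "i < n" for i
    using Tx[OF that] by (cases "e i > 0") (auto intro: mult_nonpos_nonneg)
  then have "(\<Sum>i<n. e i * (cmod ((T *\<^sub>v x) $ i))\<^sup>2) \<le> 0" by (intro sum_nonpos) auto
  then have "(\<Sum>i<n. d i * (cmod ((S *\<^sub>v x) $ i))\<^sup>2) = 0"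
    using eq[OF x(1)] nonneg by (metis (no_types, lifting) antisym lessThan_iff sum_nonneg)
  then have "\<forall>i<n. d i * (cmod ((S *\<^sub>v x) $ i))\<^sup>2 = 0"
    using nonneg by (subst (asm) sum_nonneg_eq_0_iff) auto
  then have "S *\<^sub>v x = 0\<^sub>v n" using Sx S by (intro eq_vecI) force+
  then show False using x S det_0_iff_vec_prod_zero[OF S(1)] by auto
qed

theorem sylvester_law_of_inertia:
  assumes S: "S \<in> carrier_mat n n" "det S \<noteq> 0" and T: "T \<in> carrier_mat n n" "det T \<noteq> 0"
    and eq: "diag_form n S d = diag_form n T e"
  shows "card {i. i < n \<and> d i > 0} = card {i. i < n \<and> e i > 0}"
    and "card {i. i < n \<and> d i < 0} = card {i. i < n \<and> e i < 0}"
proof -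
  have q: "(\<Sum>i<n. d i * (cmod ((S *\<^sub>v x) $ i))\<^sup>2) = (\<Sum>i<n. e i * (cmod ((T *\<^sub>v x) $ i))\<^sup>2)"
    if "x \<in> carrier_vec n" for x
    using arg_cong[OF eq, of "\<lambda>A. (A *\<^sub>v x) \<bullet>c x"]
    unfolding quadratic_form_diag_form[OF S(1) that] quadratic_form_diag_form[OF T(1) that]
    by (simp only: of_real_eq_iff)
  have q': "(\<Sum>i<n. - d i * (cmod ((S *\<^sub>v x) $ i))\<^sup>2) = (\<Sum>i<n. - e i * (cmod ((T *\<^sub>v x) $ i))\<^sup>2)"
    if "x \<in> carrier_vec n" for x
    using q[OF that] by (simp add: sum_negf)
  show "card {i. i < n \<and> d i > 0} = card {i. i < n \<and> e i > 0}"
    using q by (intro antisym card_pos_le_if_diag_forms_eq[OF S T(1)] card_pos_le_if_diag_forms_eq[OF T S(1)]) auto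
  show "card {i. i < n \<and> d i < 0} = card {i. i < n \<and> e i < 0}"
    using card_pos_le_if_diag_forms_eq[OF S T(1), of "\<lambda>i. - d i" "\<lambda>i. - e i"]
      card_pos_le_if_diag_forms_eq[OF T S(1), of "\<lambda>i. - e i" "\<lambda>i. - d i"] q'
    by (intro antisym) auto
qed

section \<open>Hermitian matrices are congruent to the diagonal of their eigenvalues\<close>

text \<open>
  Extend \<open>v\<close> to a basis, orthogonalise it and normalise the columns. Orthogonality alone would not
  do: conjugating a Hermitian matrix by a matrix with orthogonal columns of different lengths gives
  a similar matrix that need not be Hermitian, and the deflation below needs it to be both.
\<close>

lemma unitary_with_first_col:
  fixes v :: "complex vec"
  assumes v: "v \<in> carrier_vec n" "v \<noteq> 0\<^sub>v n"
  shows "\<exists>U \<in> carrier_mat n n. mat_adjoint U * U = 1\<^sub>m n \<and> (\<exists>c. col U 0 = c \<cdot>\<^sub>v v)"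
proof -
  have n: "n > 0" using v by (cases n) auto
  interpret cof_vec_space n "TYPE(complex)" .
  define b where "b = basis_completion v"
  from basis_completion[OF v, folded b_def]
  have dist_b: "distinct b" and indep: "\<not> lin_dep (set b)" and b: "set b \<subseteq> carrier_vec n"
    and hdb: "hd b = v" and len_b: "length b = n" by auto
  obtain vs where bv: "b = v # vs" using hdb len_b n by (cases b) auto
  define ws where "ws = gram_schmidt n b"
  have ws: "set ws \<subseteq> carrier_vec n" "corthogonal ws" "length ws = n"
    using gram_schmidt_result[OF b dist_b indep ws_def] by (auto simp: len_b)
  have "hd ws = v" unfolding ws_def bv using v by simp
  then have ws0: "ws ! 0 = v" using ws(3) n by (cases ws) auto
  have wsc: "ws ! j \<in> carrier_vec n" if "j < n" for j using ws that by auto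
  define N where "N j = (\<Sum>i<n. (cmod (ws ! j $ i))\<^sup>2)" for j
  have N: "ws ! j \<bullet>c ws ! j = of_real (N j)" if "j < n" for j
    using wsc[OF that]
    by (simp add: scalar_prod_def N_def atLeast0LessThan flip: complex_norm_square)
  have N0: "N j > 0" if "j < n" for j
  proof -
    have "N j \<noteq> 0" using corthogonalD[OF ws(2), of j j] that ws(3) N[OF that] by auto
    moreover have "N j \<ge> 0" by (auto simp: N_def intro!: sum_nonneg)
    ultimately show ?thesis by simp
  qed
  define U where "U = mat n n (\<lambda>(i, j). ws ! j $ i / of_real (sqrt (N j)))"
  have U: "U \<in> carrier_mat n n" by (simp add: U_def)
  have "mat_adjoint U * U = 1\<^sub>m n"
  proof (intro eq_matI)
    fix a b assume "a < dim_row (1\<^sub>m n)" "b < dim_col (1\<^sub>m n)"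
    then have ab: "a < n" "b < n" by auto
    have "(mat_adjoint U * U) $$ (a, b)
        = (\<Sum>i<n. cnj (ws ! a $ i) / of_real (sqrt (N a)) * (ws ! b $ i / of_real (sqrt (N b))))"
      using U ab by (simp add: scalar_prod_def atLeast0LessThan) (simp add: U_def)
    also have "\<dots> = (ws ! b \<bullet>c ws ! a) / (of_real (sqrt (N a)) * of_real (sqrt (N b)))"
      using wsc[OF ab(1)] wsc[OF ab(2)]
      by (simp add: scalar_prod_def atLeast0LessThan sum_divide_distrib mult_ac)
    also have "\<dots> = 1\<^sub>m n $$ (a, b)"
    proof (cases "a = b")
      case True
      have "of_real (sqrt (N a)) * of_real (sqrt (N a)) = complex_of_real (N a)"
        using N0[OF ab(1)] by (simp flip: of_real_mult)
      then show ?thesis using True ab N N0[OF ab(1)] by simp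
    next
      case False
      then show ?thesis using ab corthogonalD[OF ws(2), of b a] ws(3) by simp
    qed
    finally show "(mat_adjoint U * U) $$ (a, b) = 1\<^sub>m n $$ (a, b)" .
  qed (use U in auto)
  moreover have "col U 0 = (1 / of_real (sqrt (N 0))) \<cdot>\<^sub>v v"
    using n v by (intro eq_vecI) (auto simp: U_def ws0)
  ultimately show ?thesis using U by blast
qed

lemma diag_form_mult_right:
  assumes "S \<in> carrier_mat n n" "V \<in> carrier_mat n n"
  shows "diag_form n (S * V) d = mat_adjoint V * diag_form n S d * V"
proof -
  note [simp] = assoc_mult_mat[of _ n n _ n _ n] mult_carrier_mat[of _ n n _ n]
  show ?thesis using assms by (simp add: diag_form_def mat_adjoint_mult[of _ n n _ n])
qed

text \<open>
  The induction step of the diagonalisation: a new eigenvalue in the corner extends a diagonal form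
  of the remaining block.
\<close>

lemma diag_form_Cons_block:
  assumes S: "S \<in> carrier_mat m m"
  shows "diag_form (Suc m) (four_block_mat (1\<^sub>m 1) (0\<^sub>m 1 m) (0\<^sub>m m 1) S) ((!) (d # ds))
    = four_block_mat (mat 1 1 (\<lambda>_. of_real d)) (0\<^sub>m 1 m) (0\<^sub>m m 1) (diag_form m S ((!) ds))"
    (is "diag_form _ ?S _ = ?R")
proof (intro eq_matI)
  have S': "?S \<in> carrier_mat (Suc m) (Suc m)" using S by auto
  fix a b assume "a < dim_row ?R" "b < dim_col ?R"
  then have ab: "a < Suc m" "b < Suc m" using S by auto
  have R: "?R $$ (a, b) = (if a = 0 then if b = 0 then of_real d else 0
      else if b = 0 then 0 else diag_form m S ((!) ds) $$ (a - 1, b - 1))"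
    using ab S by (subst index_mat_four_block) auto
  show "diag_form (Suc m) ?S ((!) (d # ds)) $$ (a, b) = ?R $$ (a, b)"
    unfolding R diag_form_index[OF S' ab] sum.lessThan_Suc_shift
    using ab S diag_form_index[OF S, of "a - 1" "b - 1" "(!) ds"]
    by auto
qed (use S in auto)

text \<open>
  The spectral theorem, reduced to what the inertia needs: the coefficients are the eigenvalues with
  their multiplicities and in the given order, while \<open>S\<close> is only known to be invertible. The proof
  deflates. A unitary \<open>U\<close> that starts with an eigenvector turns \<open>A\<close> into a Hermitian matrix with first
  column \<open>e\<close> times the first unit vector. By symmetry its first row has the same shape, \<open>e\<close> is real,
  and the rest is a smaller Hermitian block with the remaining eigenvalues.
\<close>

theorem hermitian_congruent_to_eigenvalues:
  fixes A :: "complex mat"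
  assumes "A \<in> carrier_mat n n" "mat_adjoint A = A"
    and "char_poly A = (\<Prod>a \<leftarrow> es. [:- a, 1:])"
  shows "\<exists>S \<in> carrier_mat n n. det S \<noteq> 0 \<and>
    (\<exists>ds. es = map complex_of_real ds \<and> length ds = n \<and> A = diag_form n S ((!) ds))"
  using assms
proof (induction es arbitrary: n A)
  case Nil
  then have "n = 0" using degree_monic_char_poly[of A n] by simp
  then have "A = diag_form n (1\<^sub>m n) ((!) [])"
    using Nil diag_form_carrier[of "1\<^sub>m n" n "(!) []"] by (intro eq_matI) auto
  then show ?case using Nil \<open>n = 0\<close> by (intro bexI[of _ "1\<^sub>m n"]) auto
next
  case (Cons e es)
  note A = Cons.prems(1)
  have e: "eigenvalue A e"
    unfolding eigenvalue_root_char_poly[OF A] Cons.prems(3) by simp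
  then obtain v where v: "v \<in> carrier_vec n" "v \<noteq> 0\<^sub>v n" "A *\<^sub>v v = e \<cdot>\<^sub>v v"
    using A by (auto simp: eigenvalue_def eigenvector_def)
  then obtain m where n: "n = Suc m" by (cases n) auto
  obtain U c where U: "U \<in> carrier_mat n n" "mat_adjoint U * U = 1\<^sub>m n" and col: "col U 0 = c \<cdot>\<^sub>v v"
    using unitary_with_first_col[OF v(1,2)] by auto
  define V where "V = mat_adjoint U"
  have V: "V \<in> carrier_mat n n" and VU: "V * U = 1\<^sub>m n" and adjV: "mat_adjoint V = U"
    using U by (auto simp: V_def)
  have UV: "U * V = 1\<^sub>m n" using mat_mult_left_right_inverse[OF V U(1) VU] .
  define A' where "A' = V * A * U"
  have A': "A' \<in> carrier_mat n n" using U V A by (auto simp: A'_def)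
  note assoc = assoc_mult_mat[of _ n n _ n _ n] mult_carrier_mat[of _ n n _ n]
  have adj: "mat_adjoint A' = A'"
    using U V A Cons.prems(2)
    by (simp add: A'_def mat_adjoint_mult[of _ n n _ n] assoc adjV V_def[symmetric])
  have AA': "A = U * A' * V"
  proof -
    have "U * A' * V = (U * V) * A * (U * V)"
      using U V A by (simp add: A'_def assoc del: UV)
    then show ?thesis using A UV by simp
  qed
  have "similar_mat_wit A A' U V"
    by (rule similar_mat_witI[of _ _ n]) (use U V A A' UV VU AA' in auto)
  then have cp: "char_poly A = char_poly A'"
    by (intro char_poly_similar) (auto simp: similar_mat_def)
  have "col A' 0 = V *\<^sub>v (A *\<^sub>v col U 0)"
  proof -
    have "A' = V * (A * U)" using U V A by (simp add: A'_def assoc)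
    then have "col A' 0 = V *\<^sub>v col (A * U) 0"
      using col_mult2[OF V mult_carrier_mat[OF A U(1)], of 0] n by simp
    also have "col (A * U) 0 = A *\<^sub>v col U 0"
      using col_mult2[OF A U(1), of 0] n by simp
    finally show ?thesis .
  qed
  also have "\<dots> = e \<cdot>\<^sub>v (V *\<^sub>v col U 0)"
    using A V v by (simp add: col mult_mat_vec[of _ n n] smult_smult_assoc mult.commute)
  also have "V *\<^sub>v col U 0 = col (1\<^sub>m n) 0"
    using col_mult2[OF V U(1), of 0, unfolded VU] n by simp
  finally have col0: "A' $$ (i, 0) = (if i = 0 then e else 0)" if "i < n" for i
    using A' that n by (auto simp: vec_eq_iff)
  have row0: "A' $$ (0, j) = cnj (A' $$ (j, 0))" if "j < n" for j
    using A' that n arg_cong[OF adj, of "\<lambda>M. M $$ (0, j)"] by auto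
  define B where "B = mat m m (\<lambda>(i, j). A' $$ (Suc i, Suc j))"
  have B: "B \<in> carrier_mat m m" by (simp add: B_def)
  have block: "A' = four_block_mat (mat 1 1 (\<lambda>_. e)) (0\<^sub>m 1 m) (0\<^sub>m m 1) B"
  proof (rule eq_matI, goal_cases)
    case (1 i j)
    then show ?case using B n row0[of j] col0[of i] col0[of j]
      by (auto simp: B_def less_Suc_eq_0_disj)
  qed (use A' n B in auto)
  have "cnj e = e" using row0[of 0] col0[of 0] n by simp
  then obtain d where d: "e = of_real d" by (metis Reals_cases Reals_cnj_iff)
  have adjB: "mat_adjoint B = B"
  proof (rule eq_matI, goal_cases)
    case (1 i j)
    then show ?case using B n A' arg_cong[OF adj, of "\<lambda>M. M $$ (Suc i, Suc j)"]
      by (auto simp: B_def)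
  qed (use B in auto)
  have "char_poly A' = char_poly (mat 1 1 (\<lambda>_. e)) * char_poly B"
    unfolding block by (rule char_poly_four_block_zeros_col) (use B in auto)
  also have "char_poly (mat 1 1 (\<lambda>_. e)) = [:- e, 1:]"
    by (simp add: char_poly_defs det_def sign_def)
  finally have "[:- e, 1:] * char_poly B = [:- e, 1:] * (\<Prod>a \<leftarrow> es. [:- a, 1:])"
    using cp Cons.prems(3) by simp
  then have cpB: "char_poly B = (\<Prod>a \<leftarrow> es. [:- a, 1:])"
    by (metis mult_cancel_left pCons_eq_0_iff zero_neq_one)
  obtain S ds where S: "S \<in> carrier_mat m m" "det S \<noteq> 0" and ds: "es = map complex_of_real ds"
    "length ds = m" and BS: "B = diag_form m S ((!) ds)"
    using Cons.IH[OF B adjB cpB] by blast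
  define S' where "S' = four_block_mat (1\<^sub>m 1) (0\<^sub>m 1 m) (0\<^sub>m m 1) S"
  have S': "S' \<in> carrier_mat n n" using S n by (auto simp: S'_def)
  have "det S' = det S"
    unfolding S'_def by (subst det_four_block_mat_lower_left_zero[of _ 1 _ m]) (use S in auto)
  moreover have "det V \<noteq> 0"
    using det_mult[OF V U(1)] VU by auto
  ultimately have "det (S' * V) \<noteq> 0"
    using S by (simp add: det_mult[OF S' V])
  moreover have "A = diag_form n (S' * V) ((!) (d # ds))"
  proof -
    have "diag_form n S' ((!) (d # ds)) = A'"
      unfolding n S'_def diag_form_Cons_block[OF S(1)] block BS d ..
    then show ?thesis
      unfolding diag_form_mult_right[OF S' V] adjV using AA' by simp
  qed
  ultimately show ?case
    using S' V n ds d
    by (intro bexI[of _ "S' * V"] conjI exI[of _ "d # ds"]) auto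
qed

section \<open>The partial inertia of a diagonal form\<close>

lemma proots_prod_linear:
  fixes as :: "'a :: idom list"
  shows "proots (\<Prod>a \<leftarrow> as. [:- a, 1:]) = mset as"
proof (induction as)
  case (Cons a as)
  have "(\<Prod>a \<leftarrow> as. [:- a, 1:]) \<noteq> 0" by (auto simp: prod_list_zero_iff)
  then show ?case using Cons by (simp add: proots_mult del: mult_pCons_left)
qed simp

text \<open>
  Counting roots of the characteristic polynomial with multiplicity amounts to counting positions
  in the list of eigenvalues; applied to both signs, this evaluates the two components of the
  partial inertia.
\<close>

lemma eigenvalue_multiplicities_sum:
  fixes A :: "complex mat"
  assumes A: "A \<in> carrier_mat n n"
    and cp: "char_poly A = (\<Prod>a \<leftarrow> map complex_of_real ds. [:- a, 1:])" and len: "length ds = n"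
  shows "(\<Sum>x | eigenvalue A (complex_of_real x) \<and> P x. order (complex_of_real x) (char_poly A))
    = card {i. i < n \<and> P (ds ! i)}"
proof -
  have nz: "char_poly A \<noteq> 0" using degree_monic_char_poly[OF A] by auto
  have "proots (char_poly A) = mset (map complex_of_real ds)"
    unfolding cp by (rule proots_prod_linear)
  then have ord: "order (complex_of_real x) (char_poly A) = card {i. i < n \<and> ds ! i = x}" for x
  proof -
    assume roots: "proots (char_poly A) = mset (map complex_of_real ds)"
    have "order (complex_of_real x) (char_poly A) = count (image_mset complex_of_real (mset ds)) (of_real x)"
      using nz roots by (simp flip: count_proots)
    also have "\<dots> = count (mset ds) x"
      by (induction ds) auto
    also have "\<dots> = card {i. i < n \<and> ds ! i = x}"
      using len by (simp add: count_mset count_list_eq_length_filter length_filter_conv_card eq_commute)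
    finally show ?thesis .
  qed
  have ev: "eigenvalue A (complex_of_real x) \<longleftrightarrow> x \<in> set ds" for x
    unfolding eigenvalue_root_char_poly[OF A] cp by (auto simp: poly_prod_list prod_list_zero_iff)
  have "(\<Sum>x | eigenvalue A (complex_of_real x) \<and> P x. order (complex_of_real x) (char_poly A))
      = (\<Sum>x \<in> {x \<in> set ds. P x}. card {i. i < n \<and> ds ! i = x})"
    by (simp add: ord ev)
  also have "\<dots> = card (\<Union>x \<in> {x \<in> set ds. P x}. {i. i < n \<and> ds ! i = x})"
    by (subst card_UN_disjoint) auto
  also have "(\<Union>x \<in> {x \<in> set ds. P x}. {i. i < n \<and> ds ! i = x}) = {i. i < n \<and> P (ds ! i)}"
    using len by auto
  finally show ?thesis .
qed

lemma hermitian_eq_diag_form: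
  assumes A: "A \<in> carrier_mat n n" "hermitian_mat A"
  shows "\<exists>S \<in> carrier_mat n n. det S \<noteq> 0 \<and> (\<exists>d. A = diag_form n S d \<and>
    pin A = (card {i. i < n \<and> d i > 0}, card {i. i < n \<and> d i < 0}))"
proof -
  obtain es where es: "char_poly A = (\<Prod>a \<leftarrow> es. [:- a, 1:])"
    using char_poly_factorized[OF A(1)] by blast
  obtain S ds where S: "S \<in> carrier_mat n n" "det S \<noteq> 0" and ds: "es = map complex_of_real ds"
    "length ds = n" and AS: "A = diag_form n S ((!) ds)"
    using hermitian_congruent_to_eigenvalues[OF A(1) _ es] A(2) by (auto simp: hermitian_mat_def)
  have "pin A = (card {i. i < n \<and> ds ! i > 0}, card {i. i < n \<and> ds ! i < 0})"
    using eigenvalue_multiplicities_sum[OF A(1) es[unfolded ds(1)] ds(2), of "\<lambda>x. x > 0"]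
      eigenvalue_multiplicities_sum[OF A(1) es[unfolded ds(1)] ds(2), of "\<lambda>x. x < 0"]
    by (simp add: pin_def num_pos_eigenvalues_def num_neg_eigenvalues_def)
  then show ?thesis using S AS by blast
qed

text \<open>
  The diagonal form is Hermitian, so it also has a representation by its eigenvalues, for which the
  claim is a count of roots. The law of inertia transfers it to the given representation.
\<close>

lemma pin_diag_form:
  assumes S: "S \<in> carrier_mat n n" "det S \<noteq> 0"
  shows "pin (diag_form n S d) = (card {i. i < n \<and> d i > 0}, card {i. i < n \<and> d i < 0})"
proof -
  obtain T e where T: "T \<in> carrier_mat n n" "det T \<noteq> 0" and eq: "diag_form n S d = diag_form n T e"
    and pin: "pin (diag_form n S d) = (card {i. i < n \<and> e i > 0}, card {i. i < n \<and> e i < 0})"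
    using hermitian_eq_diag_form[OF diag_form_carrier[OF S(1)] hermitian_diag_form[OF S(1)], of d] by blast
  show ?thesis
    using pin sylvester_law_of_inertia[OF S T eq] by simp
qed

section \<open>Changing zero coefficients by perturbing the diagonal\<close>

text \<open>
  Row \<open>j\<close> of \<open>S\<close> has weight zero and is free to be replaced by the unit vector \<open>e\<^sub>k\<close>. Expanding along
  this row, the new determinant is the cofactor of \<open>S\<close> at \<open>(j, k)\<close>, and \<open>det S \<noteq> 0\<close> forces one of these
  cofactors to be nonzero. In matrix terms, \<open>e\<^sub>k\<close> is a coordinate vector outside the range of the
  singular matrix \<open>diag_form n S d\<close>.
\<close>

lemma exists_rank_one_update_of_zero:
  assumes S: "S \<in> carrier_mat n n" "det S \<noteq> 0" and j: "j < n" "d j = 0"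
  shows "\<exists>k<n. \<exists>S' \<in> carrier_mat n n. det S' \<noteq> 0 \<and> diag_form n S' (d(j := t))
    = diag_form n S d + mat n n (\<lambda>(a, b). if a = k \<and> b = k then of_real t else 0)"
proof -
  obtain k where k: "k < n" "cofactor S j k \<noteq> 0"
    using S(2) unfolding laplace_expansion_row[OF S(1) j(1)]
    by (metis (no_types, lifting) lessThan_iff mult_zero_right sum.neutral)
  define S' where "S' = mat n n (\<lambda>(i, b). if i = j then (if b = k then 1 else 0) else S $$ (i, b))"
  have S': "S' \<in> carrier_mat n n" by (simp add: S'_def)
  have "mat_delete S' j b = mat_delete S j b" for b
    using S(1) by (intro eq_matI) (auto simp: mat_delete_def S'_def)
  then have cof: "cofactor S' j b = cofactor S j b" for b
    by (simp add: cofactor_def)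
  have "det S' = (\<Sum>b<n. if b = k then cofactor S j b else 0)"
    unfolding laplace_expansion_row[OF S' j(1)] cof
    using j by (intro sum.cong) (auto simp: S'_def)
  also have "\<dots> = cofactor S j k" using k by simp
  finally have "det S' \<noteq> 0" using k by simp
  moreover have "diag_form n S' (d(j := t))
    = diag_form n S d + mat n n (\<lambda>(a, b). if a = k \<and> b = k then of_real t else 0)" (is "_ = ?R")
  proof (intro eq_matI)
    fix a b assume "a < dim_row ?R" "b < dim_col ?R"
    then have ab: "a < n" "b < n" by auto
    have R: "?R $$ (a, b) = diag_form n S d $$ (a, b) + (if a = k \<and> b = k then of_real t else 0)"
      using ab by (subst index_add_mat) auto
    have split: "(\<Sum>i<n. f i) = f j + (\<Sum>i\<in>{..<n} - {j}. f i)" for f :: "nat \<Rightarrow> complex"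
      using j by (simp add: sum.remove)
    show "diag_form n S' (d(j := t)) $$ (a, b) = ?R $$ (a, b)"
      unfolding R diag_form_index[OF S' ab] diag_form_index[OF S(1) ab] split
      using ab j by (auto simp: S'_def intro!: sum.cong)
  qed (use S(1) S' in auto)
  ultimately show ?thesis using k(1) S' by blast
qed

text \<open>
  The perturbation of one zero coefficient, repeated over \<open>J\<close>. Each step changes the
  coefficient of one position only, so the later positions are still zero when their turn comes.
\<close>

lemma graph_mats_reassign_zeros:
  assumes verts: "pverts G = {..<n}"
    and S: "S \<in> carrier_mat n n" "det S \<noteq> 0" and A: "diag_form n S d \<in> graph_mats G"
    and J: "finite J" "J \<subseteq> {j. j < n \<and> d j = 0}"
  shows "\<exists>S' \<in> carrier_mat n n. det S' \<noteq> 0 \<and>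
    (let B = diag_form n S' (\<lambda>i. if i \<in> J then f i else d i)
     in B \<in> graph_mats G \<and> (elements_mat (diag_form n S d) \<subseteq> \<real> \<longrightarrow> elements_mat B \<subseteq> \<real>))"
  using J
proof (induction J)
  case empty
  then show ?case using S A by (auto simp: Let_def)
next
  case (insert j J)
  define d' where "d' = (\<lambda>i. if i \<in> J then f i else d i)"
  obtain S1 where S1: "S1 \<in> carrier_mat n n" "det S1 \<noteq> 0" "diag_form n S1 d' \<in> graph_mats G"
    "elements_mat (diag_form n S d) \<subseteq> \<real> \<longrightarrow> elements_mat (diag_form n S1 d') \<subseteq> \<real>"
    using insert by (auto simp: Let_def d'_def)
  have j: "j < n" "d' j = 0" using insert by (auto simp: d'_def)
  obtain k S2 where k: "k < n" and S2: "S2 \<in> carrier_mat n n" "det S2 \<noteq> 0"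
    and eq: "diag_form n S2 (d'(j := f j)) = diag_form n S1 d' +
      mat n n (\<lambda>(a, b). if a = k \<and> b = k then of_real (f j) else 0)"
    using exists_rank_one_update_of_zero[where d = d' and t = "f j", OF S1(1,2) j] by metis
  have upd: "d'(j := f j) = (\<lambda>i. if i \<in> insert j J then f i else d i)"
    by (auto simp: d'_def)
  have ent: "diag_form n S2 (d'(j := f j)) $$ (a, b) = diag_form n S1 d' $$ (a, b) +
      (if a = k \<and> b = k then of_real (f j) else 0)" if "a < n" "b < n" for a b
    unfolding eq using that by (subst index_add_mat) auto
  have "diag_form n S2 (d'(j := f j)) \<in> graph_mats G"
    using S1(3) diag_form_carrier[OF S2(1), of "d'(j := f j)"] hermitian_diag_form[OF S2(1), of "d'(j := f j)"]
    by (auto simp: graph_mats_def verts ent)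
  moreover have "elements_mat (diag_form n S2 (d'(j := f j))) \<subseteq> \<real>"
    if "elements_mat (diag_form n S1 d') \<subseteq> \<real>"
  proof
    fix x assume "x \<in> elements_mat (diag_form n S2 (d'(j := f j)))"
    then obtain a b where ab: "a < n" "b < n" "x = diag_form n S2 (d'(j := f j)) $$ (a, b)"
      using S2 by (auto simp: elements_mat_def)
    have "diag_form n S1 d' $$ (a, b) \<in> \<real>"
      using that ab diag_form_carrier[OF S1(1), of d'] by auto
    then show "x \<in> \<real>" using ab ent by auto
  qed
  ultimately show ?case
    using S2 S1(4) by (auto simp: Let_def upd intro!: bexI[of _ S2])
qed

theorem lemma1p1:
  fixes G :: "nat pair_pre_digraph" and n p q r s :: nat and A :: "complex mat"
  assumes "pair_graph G"
    and "pverts G = {..<n}"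
    and "A \<in> graph_mats G"
    and "pin A = (p, q)"
    and "r \<ge> p"
    and "s \<ge> q"
    and "r + s \<le> n"
  shows "(\<exists>B \<in> graph_mats G. pin B = (r, s)) \<and>
    (elements_mat A \<subseteq> \<real> \<longrightarrow> (\<exists>B \<in> graph_mats G. pin B = (r, s) \<and> elements_mat B \<subseteq> \<real>))"
proof -
  have "A \<in> carrier_mat n n" "hermitian_mat A"
    using assms(2,3) by (auto simp: graph_mats_def)
  from hermitian_eq_diag_form[OF this] obtain S d where S: "S \<in> carrier_mat n n" "det S \<noteq> 0" and A: "A = diag_form n S d"
    and pinA: "pin A = (card {i. i < n \<and> d i > 0}, card {i. i < n \<and> d i < 0})"
    by blast
  define Z where "Z = {i. i < n \<and> d i = 0}"
  have pq: "card {i. i < n \<and> d i > 0} = p" "card {i. i < n \<and> d i < 0} = q"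
    using pinA assms(4) by auto
  have "{..<n} = Z \<union> ({i. i < n \<and> d i > 0} \<union> {i. i < n \<and> d i < 0})"
    by (auto simp: Z_def)
  then have "n = card (Z \<union> ({i. i < n \<and> d i > 0} \<union> {i. i < n \<and> d i < 0}))"
    by (metis card_lessThan)
  also have "\<dots> = card Z + (p + q)"
    unfolding pq[symmetric] by (subst card_Un_disjoint; (subst card_Un_disjoint)?) (auto simp: Z_def)
  finally have "(r - p) + (s - q) \<le> card Z" using assms(5-7) by simp
  then obtain J where J: "J \<subseteq> Z" "card J = (r - p) + (s - q)" "finite J"
    by (metis obtain_subset_with_card_n)
  obtain J1 where J1: "J1 \<subseteq> J" "card J1 = r - p" "finite J1"
    by (metis J(2) le_add1 obtain_subset_with_card_n)
  have J2: "card (J - J1) = s - q" using J J1 by (simp add: card_Diff_subset)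
  \<comment> \<open>Any positive and any negative number would do as the new coefficients.\<close>
  define f :: "nat \<Rightarrow> real" where "f i = (if i \<in> J1 then 1 else - 1)" for i
  define d' where "d' = (\<lambda>i. if i \<in> J then f i else d i)"
  obtain S' where S': "S' \<in> carrier_mat n n" "det S' \<noteq> 0" "diag_form n S' d' \<in> graph_mats G"
    "elements_mat A \<subseteq> \<real> \<longrightarrow> elements_mat (diag_form n S' d') \<subseteq> \<real>"
    using graph_mats_reassign_zeros[OF assms(2) S, of d J f] J assms(3)
    by (auto simp: Let_def d'_def A Z_def)
  have "{i. i < n \<and> d' i > 0} = J1 \<union> {i. i < n \<and> d i > 0}"
    using J J1 by (auto simp: d'_def f_def Z_def split: if_splits)
  moreover have "card (J1 \<union> {i. i < n \<and> d i > 0}) = r"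
    using J J1 pq assms(5) by (subst card_Un_disjoint) (auto simp: Z_def)
  moreover have "{i. i < n \<and> d' i < 0} = (J - J1) \<union> {i. i < n \<and> d i < 0}"
    using J J1 by (auto simp: d'_def f_def Z_def split: if_splits)
  moreover have "card ((J - J1) \<union> {i. i < n \<and> d i < 0}) = s"
    using J J2 pq assms(6) by (subst card_Un_disjoint) (auto simp: Z_def)
  ultimately have "pin (diag_form n S' d') = (r, s)"
    by (simp add: pin_diag_form[OF S'(1,2)])
  then show ?thesis using S'(3,4) by blast
qed

end
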